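(* Let $n$ be a positive integer. If a finitary coarse space $(X,\mathcal E)$ admits an almost free action of the group $\mathbb Z^n$, then $\operatorname{asdim}(X,\mathcal E)\ge n$.
   Context: An entourage on a set $X$ is a subset $E\subseteq X\times X$ such that $\Delta_X\subseteq E=E^{-1}$, where $\Delta_X=\{(x,x):x\in X\}$ and $E^{-1}=\{(y,x):(x,y)\in E\}$. For entourages $E,F$ on $X$, $E\circ F=\{(x,z):\exists y\ (x,y)\in E,\ (y,z)\in F\}$. For $x\in X$, the $E$-ball around $x$ is $E[x]=\{y\in X:(x,y)\in E\}$. A coarse structure on $X$ is a family $\mathcal E$ of entourages on $X$ such that (i) $E\circ F\in\mathcal E$ for all $E,F\in\mathcal E$; (ii) an entourage $F$ on $X$ belongs to $\mathcal E$ whenever $F\subseteq E$ for some $E\in\mathcal E$. A coarse space is a pair $(X,\mathcal E)$ of a set and a coarse structure on it. The coarse structure generated by a base $\mathcal B$ consists of all entourages contained in some $B\in\mathcal B$. A coarse space $(X,\mathcal E)$ is finitary if $\sup_{x\in X}|E[x]|<\infty$ for every $E\in\mathcal E$. Let $S_X$ be the group of all bijections of $X$. For a subgroup $G\subseteq S_X$, $\mathcal E_G$ denotes the coarse structure on $X$ generated by the base consisting of the entourages $\{(x,y)\in X\times X:y\in\{x\}\cup Fx\cup F^{-1}x\}$, where $F$ runs over the finite subsets of $G$ (here $Fx=\{gx:g\in F\}$ and $F^{-1}=\{g^{-1}:g\in F\}$). A coarse space $(X,\mathcal E)$ admits an almost free action of a group $H$ if there is a subgroup $G\subseteq S_X$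 isomorphic to $H$ such that $\mathcal E_G\subseteq\mathcal E$ and for any finite set $F\subseteq G\setminus\{e\}$ ($e$ the neutral element of $G$) there is a point $x\in X$ such that $\{g\in G:gx=x\}$ is disjoint from $F$. A cover $\mathcal U$ of a coarse space $(X,\mathcal E)$ is uniformly bounded if there is $E\in\mathcal E$ with $U\times U\subseteq E$ for every $U\in\mathcal U$. The asymptotic dimension $\operatorname{asdim}(X,\mathcal E)$ is the smallest non-negative integer $n$ such that for any $E\in\mathcal E$ there is a uniformly bounded cover $\mathcal U$ of $X$ such that for every $x\in X$ the family $\{U\in\mathcal U:E[x]\cap U\ne\emptyset\}$ has cardinality $\le n+1$; if no such $n$ exists, then $\operatorname{asdim}(X,\mathcal E)=\infty$, with $\infty\ge n$ for every non-negative integer $n$. *)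

theory Defs
  imports
    "HOL-Algebra.Bij"
    "HOL-Algebra.Elementary_Groups"
    "HOL-Algebra.Product_Groups"
    "HOL-Library.Extended_Nat"
begin

definition entourage :: "'a set \<Rightarrow> ('a \<times> 'a) set \<Rightarrow> bool" where
  "entourage X E \<longleftrightarrow> E \<subseteq> X \<times> X \<and> Id_on X \<subseteq> E \<and> E = E\<inverse>"

(* Entourages are symmetric, but the composition of two of them need not be, so the usual axiom
   "E O F belongs to the structure" is read as "E O F lies below a member of the structure".
   In the presence of downward closure this says that the symmetric set
   E O F \<union> F O E is a member. Every family closed under O in the literal sense satisfies it. *)
definition coarse_structure :: "'a set \<Rightarrow> ('a \<times> 'a) set set \<Rightarrow> bool" where
  "coarse_structure X \<E> \<longleftrightarrow>
     (\<forall>E\<in>\<E>. entourage X E) \<and>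
     (\<forall>E\<in>\<E>. \<forall>F\<in>\<E>. \<exists>H\<in>\<E>. E O F \<subseteq> H) \<and>
     (\<forall>E\<in>\<E>. \<forall>F. entourage X F \<and> F \<subseteq> E \<longrightarrow> F \<in> \<E>)"

definition generated_structure :: "'a set \<Rightarrow> ('a \<times> 'a) set set \<Rightarrow> ('a \<times> 'a) set set" where
  "generated_structure X \<B> = {E. entourage X E \<and> (\<exists>B\<in>\<B>. E \<subseteq> B)}"

(* The ball E[x] is the library's relational image E `` {x}. *)
definition finitary :: "'a set \<Rightarrow> ('a \<times> 'a) set set \<Rightarrow> bool" where
  "finitary X \<E> \<longleftrightarrow>
     (\<forall>E\<in>\<E>. \<exists>N. \<forall>x\<in>X. finite (E `` {x}) \<and> card (E `` {x}) \<le> N)"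

definition action_entourage :: "'a set \<Rightarrow> ('a \<Rightarrow> 'a) set \<Rightarrow> ('a \<times> 'a) set" where
  "action_entourage X F =
     {(x, y) \<in> X \<times> X. y \<in> {x} \<union> (\<lambda>g. g x) ` F \<union> (\<lambda>g. (inv\<^bsub>BijGroup X\<^esub> g) x) ` F}"

definition action_structure :: "'a set \<Rightarrow> ('a \<Rightarrow> 'a) set \<Rightarrow> ('a \<times> 'a) set set" where
  "action_structure X G =
     generated_structure X {action_entourage X F |F. finite F \<and> F \<subseteq> G}"

definition admits_almost_free_action ::
    "'a set \<Rightarrow> ('a \<times> 'a) set set \<Rightarrow> ('b, 'm) monoid_scheme \<Rightarrow> bool" where
  "admits_almost_free_action X \<E> H \<longleftrightarrow>
     (\<exists>G. subgroup G (BijGroup X) \<and>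
          (BijGroup X)\<lparr>carrier := G\<rparr> \<cong> H \<and>
          action_structure X G \<subseteq> \<E> \<and>
          (\<forall>F. finite F \<and> F \<subseteq> G - {\<one>\<^bsub>BijGroup X\<^esub>} \<longrightarrow>
               (\<exists>x\<in>X. {g \<in> G. g x = x} \<inter> F = {})))"

definition uniformly_bounded :: "('a \<times> 'a) set set \<Rightarrow> 'a set set \<Rightarrow> bool" where
  "uniformly_bounded \<E> \<U> \<longleftrightarrow> (\<exists>E\<in>\<E>. \<forall>U\<in>\<U>. U \<times> U \<subseteq> E)"

definition asdim_le :: "'a set \<Rightarrow> ('a \<times> 'a) set set \<Rightarrow> nat \<Rightarrow> bool" where
  "asdim_le X \<E> n \<longleftrightarrow>
     (\<forall>E\<in>\<E>. \<exists>\<U>. \<Union>\<U> = X \<and> uniformly_bounded \<E> \<U> \<and>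
        (\<forall>x\<in>X. finite {U \<in> \<U>. E `` {x} \<inter> U \<noteq> {}} \<and>
               card {U \<in> \<U>. E `` {x} \<inter> U \<noteq> {}} \<le> n + 1))"

definition asdim :: "'a set \<Rightarrow> ('a \<times> 'a) set set \<Rightarrow> enat" where
  "asdim X \<E> = (if \<exists>n. asdim_le X \<E> n then enat (LEAST n. asdim_le X \<E> n) else \<infinity>)"

definition integer_power_group :: "nat \<Rightarrow> (nat \<Rightarrow> int) monoid" where
  "integer_power_group n = product_group {..<n} (\<lambda>_. integer_group)"

end

theory Submission
  imports Defs "HOL-Analysis.Brouwer_Fixpoint"
begin

text \<open>
  Suppose the asymptotic dimension is \<open>k < n\<close>. Take the entourage given by the translations with
  exponents in \<open>{0,1}\<^sup>n\<close>, a matching cover, and a bound \<open>p\<close> for the size of its members. Choose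
  a point \<open>x\<close> whose stabilizer contains no nonzero vector of the box \<open>{-p..p}\<^sup>n\<close>, and colour each
  vector \<open>a\<close> of the grid \<open>{0..p}\<^sup>n\<close> by a member of the cover that contains \<open>a x\<close>. The orbit map
  is injective on the grid, so a connected monochromatic set cannot join two opposite faces: it would
  put \<open>p + 1\<close> points into one member of the cover. As in the Lebesgue covering theorem, Sperner's lemma
  (in Kuhn's form) then yields a unit cube with \<open>n + 1\<close> vertices of distinct colours, so that a
  single ball meets \<open>n + 1 > k + 1\<close> members of the cover.
\<close>

section \<open>Monochromatic paths in the grid and a covering lemma\<close>

text \<open>The classes of the reflexive transitive closure are the monochromatic components of the
  grid. Diagonal steps count, so any two equally coloured vertices of one unit cube are
  adjacent.\<close>

definition grid_adj :: "nat \<Rightarrow> nat \<Rightarrow> ((nat \<Rightarrow> nat) \<Rightarrow> 'b) \<Rightarrow> ((nat \<Rightarrow> nat) \<times> (nat \<Rightarrow> nat)) set" where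
  "grid_adj p n c = {(a, b). (\<forall>j. a j \<le> p) \<and> (\<forall>j. b j \<le> p) \<and> c a = c b \<and>
     (\<forall>j<n. a j \<le> Suc (b j) \<and> b j \<le> Suc (a j))}"

lemma sym_grid_adj: "sym (grid_adj p n c)"
  by (auto simp: sym_def grid_adj_def)

lemma grid_path_invariant:
  assumes "(a, b) \<in> (grid_adj p n c)\<^sup>*" "\<forall>j. a j \<le> p"
  shows "c b = c a \<and> (\<forall>j. b j \<le> p)"
  using assms by (induction rule: rtrancl_induct) (auto simp: grid_adj_def)

text \<open>Discrete intermediate value property: one step lowers coordinate \<open>j\<close> by at
  most 1, so no value is skipped.\<close>

lemma grid_path_intermediate:
  assumes "(a, b) \<in> (grid_adj p n c)\<^sup>*" "j < n" "b j \<le> i" "i \<le> a j"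
  shows "\<exists>d. (a, d) \<in> (grid_adj p n c)\<^sup>* \<and> d j = i"
  using assms
proof (induction rule: rtrancl_induct)
  case base
  then show ?case by (auto intro: le_antisym)
next
  case (step b b')
  show ?case
  proof (cases "b j \<le> i")
    case True
    then show ?thesis using step by blast
  next
    case False
    moreover have "b j \<le> Suc (b' j)"
      using step.hyps(2) \<open>j < n\<close> by (simp add: grid_adj_def)
    ultimately have "b' j = i" using step.prems by linarith
    then show ?thesis using step.hyps by (auto intro: rtrancl_into_rtrancl)
  qed
qed

lemma grid_covering:
  fixes c :: "(nat \<Rightarrow> nat) \<Rightarrow> 'b"
  assumes "0 < p"
    and no_span: "\<And>a b j. \<lbrakk>(a, b) \<in> (grid_adj p n c)\<^sup>*; \<forall>i. a i \<le> p; j < n; a j = p\<rbrakk> \<Longrightarrow> b j \<noteq> 0"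
  obtains q S where "\<And>a j. a \<in> S \<Longrightarrow> q j \<le> a j \<and> a j \<le> Suc (q j) \<and> a j \<le> p"
    and "inj_on c S" "card S = n + 1"
proof -
  define R where "R = (grid_adj p n c)\<^sup>*"
  \<comment> \<open>Label 0 in direction \<open>j\<close> means that the component of
    \<open>a\<close> reaches the face where coordinate \<open>j\<close> is 0. Kuhn's boundary
    conditions then follow from the empty path on that face and from \<open>no_span\<close> on the
    opposite one.\<close>
  define lab where "lab = (\<lambda>a j. if \<exists>b. (a, b) \<in> R \<and> b j = 0 then 0 else 1 :: nat)"
  have "odd (card {s. ksimplex p n s \<and> (reduced n \<circ> lab) ` s = {..n}})"
  proof (rule kuhn_combinatorial[OF \<open>0 < p\<close>])
    show "\<forall>x j. (\<forall>j. x j \<le> p) \<and> j < n \<and> x j = 0 \<longrightarrow> lab x j = 0"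
      by (auto simp: lab_def R_def)
    show "\<forall>x j. (\<forall>j. x j \<le> p) \<and> j < n \<and> x j = p \<longrightarrow> lab x j = 1"
    proof (intro allI impI)
      fix x j assume "(\<forall>j. x j \<le> p) \<and> j < n \<and> x j = p"
      then have "\<not> (\<exists>b. (x, b) \<in> R \<and> b j = 0)"
        unfolding R_def using no_span by blast
      then show "lab x j = 1"
        by (simp add: lab_def)
    qed
  qed
  then have "{s. ksimplex p n s \<and> (reduced n \<circ> lab) ` s = {..n}} \<noteq> {}"
    by (rule odd_card_imp_not_empty)
  then obtain s q u where ks: "kuhn_simplex p n q u s" and full: "(reduced n \<circ> lab) ` s = {..n}"
    by (auto elim: ksimplex.cases)
  interpret kuhn_simplex p n q u s by fact
  \<comment> \<open>\<open>S\<close> picks one vertex for each reduced label.\<close>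
  obtain S where S: "S \<subseteq> s" "bij_betw (reduced n \<circ> lab) S {..n}"
    using full by (metis subset_image_inj subset_refl inj_on_imp_bij_betw)
  have cube: "q j \<le> a j \<and> a j \<le> Suc (q j) \<and> a j \<le> p" if "a \<in> S" for a j
    using base_le le_Suc_base s_le_p S(1) that by blast
  have "inj_on c S"
  proof (rule inj_onI)
    fix a b assume ab: "a \<in> S" "b \<in> S" "c a = c b"
    \<comment> \<open>Equally coloured vertices of the cube lie in one component, on which
      \<open>lab\<close> is constant; distinct reduced labels therefore force distinct
      colours.\<close>
    have "a j \<le> Suc (b j) \<and> b j \<le> Suc (a j)" for j
      using cube[OF ab(1), of j] cube[OF ab(2), of j] by linarith
    then have "(a, b) \<in> grid_adj p n c"
      using ab(3) cube[OF ab(1)] cube[OF ab(2)] by (simp add: grid_adj_def)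
    then have "(a, b) \<in> R" "(b, a) \<in> R"
      unfolding R_def using sym_grid_adj[of p n c] by (auto dest: symD)
    then have "lab a = lab b"
      unfolding lab_def R_def by (intro ext) (meson rtrancl_trans)
    then show "a = b"
      using ab S(2) by (auto simp: bij_betw_def inj_on_def)
  qed
  moreover have "card S = n + 1"
    using bij_betw_same_card[OF S(2)] by simp
  ultimately show ?thesis
    using that cube by blast
qed

section \<open>Lower bound for an abstract translation action\<close>

text \<open>Vectors of Z^n are encoded as functions on all of \<open>nat\<close>, of which
  \<open>T\<close> sees only the first \<open>n\<close> coordinates. \<open>free\<close> supplies,
  for each box, one point moved by all its nonzero vectors.\<close>

lemma asdim_le_lower_bound:
  fixes T :: "(nat \<Rightarrow> int) \<Rightarrow> 'a \<Rightarrow> 'a"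
  assumes "finitary X \<E>" and asdim: "asdim_le X \<E> k"
    and T_in: "\<And>v x. x \<in> X \<Longrightarrow> T v x \<in> X"
    and T_add: "\<And>v w x. x \<in> X \<Longrightarrow> T (\<lambda>i. v i + w i) x = T v (T w x)"
    and T_cong: "\<And>v w. (\<And>i. i < n \<Longrightarrow> v i = w i) \<Longrightarrow> T v = T w"
    and T_zero: "\<And>x. x \<in> X \<Longrightarrow> T (\<lambda>_. 0) x = x"
    and "E \<in> \<E>" and E: "\<And>v x. \<lbrakk>x \<in> X; \<And>i. v i \<in> {0, 1}\<rbrakk> \<Longrightarrow> (x, T v x) \<in> E"
    and free: "\<And>p. \<exists>x\<in>X. \<forall>v. (\<forall>i<n. \<bar>v i\<bar> \<le> int p) \<longrightarrow> (\<exists>i<n. v i \<noteq> 0) \<longrightarrow> T v x \<noteq> x"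
  shows "n \<le> k"
proof -
  obtain \<U> where cover: "\<Union>\<U> = X" and bdd: "uniformly_bounded \<E> \<U>"
    and mult: "\<And>x. x \<in> X \<Longrightarrow> finite {U \<in> \<U>. E `` {x} \<inter> U \<noteq> {}} \<and>
               card {U \<in> \<U>. E `` {x} \<inter> U \<noteq> {}} \<le> k + 1"
    using asdim \<open>E \<in> \<E>\<close> unfolding asdim_le_def by meson
  obtain B where "B \<in> \<E>" and B: "\<And>U. U \<in> \<U> \<Longrightarrow> U \<times> U \<subseteq> B"
    using bdd unfolding uniformly_bounded_def by auto
  obtain N where N: "\<And>x. x \<in> X \<Longrightarrow> finite (B `` {x}) \<and> card (B `` {x}) \<le> N"
    using \<open>finitary X \<E>\<close> \<open>B \<in> \<E>\<close> unfolding finitary_def by meson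
  \<comment> \<open>A member of the cover lies in the \<open>B\<close>-ball of each of its points,
    so it has at most \<open>N\<close> elements; the successor also makes \<open>p\<close> positive,
    as Kuhn's lemma requires.\<close>
  define p where "p = Suc N"
  have small: "finite U \<and> card U < p" if "U \<in> \<U>" "u \<in> U" for u U
  proof -
    have "U \<subseteq> B `` {u}" "u \<in> X"
      using B[OF that(1)] that cover by auto
    then show ?thesis
      using N[of u] card_mono[of "B `` {u}" U] by (auto simp: p_def intro: finite_subset)
  qed
  obtain x where x: "x \<in> X"
    and free_x: "\<And>v. \<lbrakk>\<forall>i<n. \<bar>v i\<bar> \<le> int p; T v x = x\<rbrakk> \<Longrightarrow> \<forall>i<n. v i = 0"
    using free[of p] by blast
  define f where "f = (\<lambda>a :: nat \<Rightarrow> nat. T (\<lambda>i. int (a i)) x)"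
  have f_in: "f a \<in> X" for a
    unfolding f_def by (rule T_in[OF x])
  have f_inj: "\<forall>i<n. a i = b i" if "\<forall>i. a i \<le> p" "\<forall>i. b i \<le> p" "f a = f b" for a b
  proof -
    \<comment> \<open>Translating \<open>f a = f b\<close> by \<open>-b\<close> shows that
      \<open>a - b\<close>, a vector of the box, fixes \<open>x\<close>.\<close>
    have "T (\<lambda>i. - int (b i) + int (a i)) x = T (\<lambda>i. - int (b i) + int (b i)) x"
      using that(3) x by (simp only: T_add f_def)
    also have "\<dots> = x"
      using T_zero[OF x] by simp
    finally have eq: "T (\<lambda>i. - int (b i) + int (a i)) x = x" .
    have "\<bar>- int (b i) + int (a i)\<bar> \<le> int p" for i
      using that(1)[rule_format, of i] that(2)[rule_format, of i] by linarith
    then show ?thesis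
      using free_x[OF _ eq] by auto
  qed
  define c where "c = (\<lambda>a. SOME U. U \<in> \<U> \<and> f a \<in> U)"
  have c: "c a \<in> \<U> \<and> f a \<in> c a" for a
    unfolding c_def by (rule someI_ex) (use f_in[of a] cover in blast)
  have no_span: "b j \<noteq> 0"
    if path: "(a, b) \<in> (grid_adj p n c)\<^sup>*" and a: "\<forall>i. a i \<le> p" and "j < n" "a j = p" for a b j
  proof
    assume "b j = 0"
    then have "\<exists>d. (a, d) \<in> (grid_adj p n c)\<^sup>* \<and> d j = i" if "i \<le> p" for i
      using grid_path_intermediate[OF path \<open>j < n\<close>, of i] \<open>a j = p\<close> that by simp
    \<comment> \<open>One point of the component on each level of coordinate \<open>j\<close>: their
      \<open>p + 1\<close> images are distinct and all lie in \<open>c a\<close>, which has fewer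
      than \<open>p\<close> elements.\<close>
    then obtain d where d: "\<And>i. i \<le> p \<Longrightarrow> (a, d i) \<in> (grid_adj p n c)\<^sup>* \<and> d i j = i"
      by metis
    have d': "c (d i) = c a \<and> (\<forall>j. d i j \<le> p)" if "i \<le> p" for i
      using grid_path_invariant d[OF that] a by blast
    have "inj_on (f \<circ> d) {..p}"
    proof (rule inj_onI)
      fix i i' assume *: "i \<in> {..p}" "i' \<in> {..p}" "(f \<circ> d) i = (f \<circ> d) i'"
      then have "d i j = d i' j"
        using f_inj[of "d i" "d i'"] d' \<open>j < n\<close> by simp
      then show "i = i'"
        using d * by simp
    qed
    moreover have "(f \<circ> d) ` {..p} \<subseteq> c a"
    proof (clarsimp)
      fix i assume "i \<le> p"
      then show "f (d i) \<in> c a" using c[of "d i"] d'[of i] by simp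
    qed
    ultimately have "card {..p} \<le> card (c a)"
      using card_inj_on_le small c by blast
    then show False
      using small[of "c a" "f a"] c[of a] by simp
  qed
  obtain S q where cube: "\<And>a j. a \<in> S \<Longrightarrow> q j \<le> a j \<and> a j \<le> Suc (q j) \<and> a j \<le> p"
    and S: "inj_on c S" "card S = n + 1"
  proof (rule grid_covering[of p n c])
    show "0 < p" by (simp add: p_def)
    show "b j \<noteq> 0" if "(a, b) \<in> (grid_adj p n c)\<^sup>*" "\<forall>i. a i \<le> p" "j < n" "a j = p" for a b j
      using no_span that .
  qed (rule that)
  have "c ` S \<subseteq> {U \<in> \<U>. E `` {f q} \<inter> U \<noteq> {}}"
  proof (rule image_subsetI)
    fix a assume "a \<in> S"
    \<comment> \<open>\<open>v\<close> leads from the lowest corner \<open>q\<close> to the vertex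
      \<open>a\<close>, so the ball around \<open>f q\<close> meets every colour of
      \<open>S\<close>.\<close>
    define v where "v = (\<lambda>i. int (a i) - int (q i))"
    have "v i \<in> {0, 1}" for i
      using cube[OF \<open>a \<in> S\<close>, of i] by (auto simp: v_def)
    then have "(f q, T v (f q)) \<in> E"
      using E f_in by blast
    moreover have "T v (f q) = f a"
      unfolding f_def by (subst T_add[OF x, symmetric]) (simp add: v_def)
    ultimately show "c a \<in> {U \<in> \<U>. E `` {f q} \<inter> U \<noteq> {}}"
      using c[of a] by auto
  qed
  then have "card (c ` S) \<le> card {U \<in> \<U>. E `` {f q} \<inter> U \<noteq> {}}"
    using mult[OF f_in] by (intro card_mono) auto
  also have "\<dots> \<le> k + 1"
    using mult[OF f_in] by blast
  finally have "card (c ` S) \<le> k + 1" .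
  then show ?thesis
    using S by (simp add: card_image)
qed

section \<open>Translations obtained from the almost free action\<close>

text \<open>Symmetry holds because elements of \<open>F\<close> and their inverses both contribute.
  As \<open>generated_structure\<close> consists of entourages only, this is what places the base
  elements in it.\<close>

lemma entourage_action_entourage:
  assumes "subgroup G (BijGroup X)" "F \<subseteq> G"
  shows "entourage X (action_entourage X F)"
proof -
  interpret group "BijGroup X" by (rule group_BijGroup)
  have inv: "(inv\<^bsub>BijGroup X\<^esub> g) (g x) = x" "g ((inv\<^bsub>BijGroup X\<^esub> g) x) = x"
    if "g \<in> F" "x \<in> X" for g x
  proof -
    have g: "g \<in> Bij X"
      using assms that subgroup.subset by (fastforce simp: BijGroup_def)
    then show "(inv\<^bsub>BijGroup X\<^esub> g) (g x) = x" "g ((inv\<^bsub>BijGroup X\<^esub> g) x) = x"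
      using that Bij_imp_funcset[OF g]
      by (auto simp: f_inv_into_f inv_BijGroup Bij_def bij_betw_def Pi_iff)
  qed
  show ?thesis
    unfolding entourage_def action_entourage_def
    using inv by (auto simp: image_iff) metis+
qed

theorem theorem2:
  fixes X :: "'a set" and \<E> :: "('a \<times> 'a) set set" and n :: nat
  assumes "n > 0"
    and "coarse_structure X \<E>"
    and "finitary X \<E>"
    and "admits_almost_free_action X \<E> (integer_power_group n)"
  shows "asdim X \<E> \<ge> enat n"
proof -
  obtain G where sub: "subgroup G (BijGroup X)"
    and iso: "(BijGroup X)\<lparr>carrier := G\<rparr> \<cong> integer_power_group n"
    and struct: "action_structure X G \<subseteq> \<E>"
    and free: "\<forall>F. finite F \<and> F \<subseteq> G - {\<one>\<^bsub>BijGroup X\<^esub>} \<longrightarrow> (\<exists>x\<in>X. {g \<in> G. g x = x} \<inter> F = {})"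
    using assms(4) unfolding admits_almost_free_action_def by (elim exE conjE) (rule that)
  interpret BG: group "BijGroup X" by (rule group_BijGroup)
  interpret GG: group "(BijGroup X)\<lparr>carrier := G\<rparr>"
    using sub by (rule BG.subgroup_imp_group)
  have G_Bij: "G \<subseteq> Bij X"
    using subgroup.subset[OF sub] by (simp add: BijGroup_def)
  interpret Z: group "integer_power_group n"
    by (simp add: integer_power_group_def)
  obtain h where h: "h \<in> iso (integer_power_group n) ((BijGroup X)\<lparr>carrier := G\<rparr>)"
    using GG.iso_sym[OF iso] unfolding is_iso_def by blast
  then have h_hom: "h \<in> hom (integer_power_group n) ((BijGroup X)\<lparr>carrier := G\<rparr>)"
    and h_bij: "bij_betw h (carrier (integer_power_group n)) G"
    by (auto simp: iso_def)
  \<comment> \<open>Elements of the product group are extensional on \<open>{..<n}\<close>;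
    restriction lets \<open>T\<close> accept arbitrary integer sequences.\<close>
  define T where "T = (\<lambda>v. h (restrict v {..<n}))"
  have carr: "restrict v {..<n} \<in> carrier (integer_power_group n)" for v
    by (simp add: integer_power_group_def)
  have T_G: "T v \<in> G" for v
    using bij_betwE[OF h_bij] carr by (simp add: T_def)
  have T_in: "T v x \<in> X" if "x \<in> X" for v x
    using T_G G_Bij Bij_imp_funcset that by blast
  have T_add: "T (\<lambda>i. v i + w i) x = T v (T w x)" if "x \<in> X" for v w x
  proof -
    have "restrict (\<lambda>i. v i + w i) {..<n} =
        restrict v {..<n} \<otimes>\<^bsub>integer_power_group n\<^esub> restrict w {..<n}"
      by (auto simp: integer_power_group_def)
    then have "T (\<lambda>i. v i + w i) = T v \<otimes>\<^bsub>BijGroup X\<^esub> T w"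
      using hom_mult[OF h_hom carr carr] by (simp add: T_def)
    also have "\<dots> = compose X (T v) (T w)"
      using T_G G_Bij by (auto simp: BijGroup_def)
    finally show ?thesis
      using that by (simp add: compose_def)
  qed
  have T_cong: "T v = T w" if "\<And>i. i < n \<Longrightarrow> v i = w i" for v w
    unfolding T_def using that by (metis lessThan_iff restrict_ext)
  have one: "restrict (\<lambda>_. 0) {..<n} = \<one>\<^bsub>integer_power_group n\<^esub>"
    by (simp add: integer_power_group_def)
  have T_one: "T (\<lambda>_. 0) = \<one>\<^bsub>BijGroup X\<^esub>"
    using hom_one[OF h_hom Z.group_axioms GG.group_axioms] by (simp add: T_def one)
  then have T_zero: "T (\<lambda>_. 0) x = x" if "x \<in> X" for x
    using that by (simp add: BijGroup_def)
  have T_nontrivial: "T v \<noteq> \<one>\<^bsub>BijGroup X\<^esub>" if "i < n" "v i \<noteq> 0" for v i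
  proof
    assume "T v = \<one>\<^bsub>BijGroup X\<^esub>"
    then have "restrict v {..<n} = restrict (\<lambda>_. 0) {..<n}"
      using T_one carr h_bij unfolding T_def bij_betw_def by (metis inj_onD)
    then show False
      using that by (metis lessThan_iff restrict_apply')
  qed
  \<comment> \<open>The set of sequences may be infinite, but \<open>T\<close> factors through their
    restrictions, of which there are finitely many.\<close>
  have finite_box: "finite (T ` {v. \<forall>i<n. v i \<in> A})" if "finite A" for A
  proof (rule finite_subset)
    show "T ` {v. \<forall>i<n. v i \<in> A} \<subseteq> h ` ({..<n} \<rightarrow>\<^sub>E A)"
      by (auto simp: T_def)
    show "finite (h ` ({..<n} \<rightarrow>\<^sub>E A))"
      using that by (simp add: finite_PiE)
  qed
  define F where "F = T ` {v. \<forall>i<n. v i \<in> {0, 1}}"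
  have F: "finite F" "F \<subseteq> G"
    using finite_box[of "{0, 1}"] T_G by (auto simp: F_def)
  have E_in: "action_entourage X F \<in> \<E>"
    using struct entourage_action_entourage[OF sub F(2)] F
    unfolding action_structure_def generated_structure_def by blast
  have E: "(x, T v x) \<in> action_entourage X F" if "x \<in> X" "\<And>i. v i \<in> {0, 1}" for v x
    using that T_in by (auto simp: action_entourage_def F_def)
  have free': "\<exists>x\<in>X. \<forall>v. (\<forall>i<n. \<bar>v i\<bar> \<le> int p) \<longrightarrow> (\<exists>i<n. v i \<noteq> 0) \<longrightarrow> T v x \<noteq> x" for p
  proof -
    \<comment> \<open>By injectivity of \<open>h\<close>, removing the identity discards no nonzero
      vector of the box.\<close>
    let ?F = "T ` {v. \<forall>i<n. v i \<in> {- int p..int p}} - {\<one>\<^bsub>BijGroup X\<^esub>}"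
    have "\<exists>x\<in>X. {g \<in> G. g x = x} \<inter> ?F = {}"
      using finite_box[of "{- int p..int p}"] T_G by (intro free[rule_format] conjI) auto
    then obtain x where "x \<in> X" and x: "{g \<in> G. g x = x} \<inter> ?F = {}" by blast
    have "T v x \<noteq> x" if "\<forall>i<n. \<bar>v i\<bar> \<le> int p" "i < n" "v i \<noteq> 0" for v i
    proof -
      have "T v \<in> ?F"
        using that T_nontrivial[of i v] by (auto simp: abs_le_iff intro!: imageI)
      then show ?thesis
        using x T_G by blast
    qed
    then show ?thesis
      using \<open>x \<in> X\<close> by blast
  qed
  have "n \<le> k" if "asdim_le X \<E> k" for k
    by (rule asdim_le_lower_bound[OF assms(3) that T_in T_add T_cong T_zero E_in E free'])
  \<comment> \<open>The bound passes to the least such \<open>k\<close>; if there is none,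
    \<open>asdim\<close> is infinite.\<close>
  then show ?thesis
    unfolding asdim_def by (auto intro: LeastI2_ex)
qed

end
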